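(* Let $n\ge 1$ and let $\alpha_1,\dots,\alpha_n$ be any real numbers. Let $X_1,\dots,X_n$ be any random variables with $\mathrm{Var}(X_i)<+\infty$ for $i=1,\dots,n$. Then $$\mathrm{Var}\Big(\sum_{i=1}^n\alpha_iX_i\Big)\le\Big(\sum_{i=1}^n|\alpha_i|\Big)\sum_{i=1}^n|\alpha_i|\,\mathrm{Var}(X_i).$$
   Context: Random variables are real-valued, defined on a common probability space, with finite expectation and variance; no independence or uncorrelatedness is assumed. $\mathrm{Var}$ denotes variance. *)

theory Defs
  imports "HOL-Probability.Probability"
begin

end

theory Submission
  imports Defs
begin

text \<open>After centring each variable, the variance of the combination is the expected square of
  \<open>(\<Sum>i=1..n. \<alpha> i * ?Y i \<omega>)\<close>. Cauchy-Schwarz with weights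
  \<open>\<bar>\<alpha> i\<bar>\<close> (\<open>weighted_sum_power2_le\<close>) bounds this square
  at each outcome by a combination of the individual squares, so no covariance ever appears; taking
  expectations gives the claim.\<close>

lemma weighted_sum_power2_le:
  fixes a y :: "'i \<Rightarrow> real"
  shows "(\<Sum>i\<in>I. a i * y i)\<^sup>2 \<le> (\<Sum>i\<in>I. \<bar>a i\<bar>) * (\<Sum>i\<in>I. \<bar>a i\<bar> * (y i)\<^sup>2)"
proof -
  \<comment> \<open>Each weight is shared evenly between the two Cauchy-Schwarz factors;
    \<open>sgn\<close> restores the sign of \<open>a i\<close> and disappears on squaring.\<close>
  have "sqrt \<bar>a i\<bar> * (sgn (a i) * sqrt \<bar>a i\<bar> * y i) = a i * y i" for i
    by (simp add: sgn_if)
  moreover have "(sgn (a i) * sqrt \<bar>a i\<bar> * y i)\<^sup>2 = \<bar>a i\<bar> * (y i)\<^sup>2" for i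
    by (simp add: power_mult_distrib sgn_if)
  ultimately show ?thesis
    using Cauchy_Schwarz_ineq_sum[of "\<lambda>i. sqrt \<bar>a i\<bar>" "\<lambda>i. sgn (a i) * sqrt \<bar>a i\<bar> * y i" I]
    by (simp only: real_sqrt_pow2 abs_ge_zero)
qed

theorem theorem5:
  fixes M :: "'a measure" and X :: "nat \<Rightarrow> 'a \<Rightarrow> real"
    and \<alpha> :: "nat \<Rightarrow> real" and n :: nat
  assumes "prob_space M"
    and "n \<ge> 1"
    and "\<And>i. i \<in> {1..n} \<Longrightarrow> prob_space.random_variable M borel (X i)"
    and "\<And>i. i \<in> {1..n} \<Longrightarrow> integrable M (X i)"
    and "\<And>i. i \<in> {1..n} \<Longrightarrow>
           integrable M (\<lambda>\<omega>. (X i \<omega> - prob_space.expectation M (X i))\<^sup>2)"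
  shows "prob_space.variance M (\<lambda>\<omega>. \<Sum>i=1..n. \<alpha> i * X i \<omega>)
         \<le> (\<Sum>i=1..n. \<bar>\<alpha> i\<bar>) * (\<Sum>i=1..n. \<bar>\<alpha> i\<bar> * prob_space.variance M (X i))"
proof -
  interpret prob_space M by fact
  let ?Y = "\<lambda>i \<omega>. X i \<omega> - expectation (X i)"
  \<comment> \<open>Linearity of expectation, which rests on the integrability of each
    \<open>X i\<close>.\<close>
  have centred: "(\<Sum>i=1..n. \<alpha> i * X i \<omega>) - expectation (\<lambda>\<omega>. \<Sum>i=1..n. \<alpha> i * X i \<omega>)
      = (\<Sum>i=1..n. \<alpha> i * ?Y i \<omega>)" for \<omega>
    using assms(4) by (simp add: right_diff_distrib sum_subtractf)
  have "variance (\<lambda>\<omega>. \<Sum>i=1..n. \<alpha> i * X i \<omega>) = expectation (\<lambda>\<omega>. (\<Sum>i=1..n. \<alpha> i * ?Y i \<omega>)\<^sup>2)"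
    by (simp only: centred)
  \<comment> \<open>\<open>integral_mono'\<close> asks for integrability and nonnegativity of the
    larger integrand alone: a smaller one that failed to be integrable would have integral 0 by
    convention.\<close>
  also have "\<dots> \<le> expectation (\<lambda>\<omega>. (\<Sum>i=1..n. \<bar>\<alpha> i\<bar>) * (\<Sum>i=1..n. \<bar>\<alpha> i\<bar> * (?Y i \<omega>)\<^sup>2))"
    using assms(5)
    by (intro integral_mono' weighted_sum_power2_le integrable_mult_right integrable_sum)
       (auto intro!: mult_nonneg_nonneg sum_nonneg)
  \<comment> \<open>The expectation of the squared \<open>?Y i\<close> is
    \<open>variance (X i)\<close> by definition, so linearity suffices.\<close>
  also have "\<dots> = (\<Sum>i=1..n. \<bar>\<alpha> i\<bar>) * (\<Sum>i=1..n. \<bar>\<alpha> i\<bar> * variance (X i))"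
    using assms(5) by simp
  finally show ?thesis .
qed

end
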